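(* Let $S=\{1,\dots,N\}$, let $E,A(i),C(i)\in\mathbb{R}^{n\times n}$ ($i\in S$) with $\operatorname{rank}(E)=r\le n$, and consider the discrete-time singular stochastic Markov jump system $$Ex(k+1)=A(r_k)x(k)+C(r_k)x(k)w(k),\qquad x(0)=x_0\in\mathbb{R}^n,$$ where $w(k)\in\mathbb{R}$ is a wide stationary second-order process with $\mathbb{E}(w(k))=0$, $\mathbb{E}(w(k)w(s))=\delta_{ks}$, and $(r_k)$ is a Markov chain on $S$ with transition probability matrix $\Lambda=(\lambda_{ij})_{N\times N}$. Assume $\operatorname{rank}[E\ \ C(i)]=\operatorname{rank}(E)$ for every $i\in S$. If there exist symmetric matrices $P(i)=P^T(i)\in\mathbb{R}^{n\times n}$, $i\in S$, such that for each $i\in S$ $$E^TP(i)E\ge0,$$ $$A^T(i)\Big(\sum_{j=1}^N\lambda_{ij}P(j)\Big)A(i)+C^T(i)\Big(\sum_{j=1}^N\lambda_{ij}P(j)\Big)C(i)-E^TP(i)E<0,$$ then the system is mean square admissible.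
   Context: $\lambda_{ij}=\Pr\{r_{k+1}=j\mid r_k=i\}\ge0$, $\sum_{j=1}^N\lambda_{ij}=1$; $\delta_{ks}$ is the Kronecker delta; $R(\cdot)$ is the rank, $\mathbb{E}$ the expectation; $X<0$ ($X\ge0$) means real symmetric negative definite (positive semidefinite). Causal: for every $i\in S$ there are nonsingular $M(i),N(i)\in\mathbb{R}^{n\times n}$ such that either (a) $M(i)EN(i)=\begin{bmatrix}I_{n_1}&0\\0&N_{n_2}(i)\end{bmatrix}$, $M(i)A(i)N(i)=\begin{bmatrix}\tilde A_{11}(i)&0\\0&I_{n_2}\end{bmatrix}$, $M(i)C(i)N(i)=\begin{bmatrix}\tilde C_{11}(i)&\tilde C_{12}(i)\\0&0\end{bmatrix}$ with $N_{n_2}(i)\in\mathbb{R}^{n_2\times n_2}$ nilpotent, $\tilde A_{11}(i),\tilde C_{11}(i)\in\mathbb{R}^{n_1\times n_1}$, $n_1+n_2=n$, and moreover $\deg(\det(sE-A(i)))=R(E)$; or (b) $M(i)EN(i)=\begin{bmatrix}I_r&0\\0&0\end{bmatrix}$, $M(i)A(i)N(i)=\begin{bmatrix}\bar A_{11}(i)&0\\0&I_{n-r}\end{bmatrix}$, $M(i)C(i)N(i)=\begin{bmatrix}\bar C_{11}(i)&\bar C_{12}(i)\\0&\bar C_{22}(i)\end{bmatrix}$ with $\bar A_{11}(i),\bar C_{11}(i)\in\mathbb{R}^{r\times r}$. Asymptotically stable in the mean square: the system has a unique solution and $\lim_{k\to\infty}\mathbb{E}\{\|x(k)\|^2\mid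 x_0,r_0\}=0$ for any initial condition $x_0\in\mathbb{R}^n$. Mean square admissible: the system has a unique solution, is causal, and is asymptotically stable in the mean square.
   Formalization: Added: given the whole chain (r_k) and the earlier noise, w(k) has conditional mean 0 and conditional variance 1 (uncorrelated noise alone does not suffice); the initial condition x(0)=x_0 is imposed as E x(0)=E x_0, since singular E makes x(0)=x_0 unsolvable for some x_0. *)

theory Defs
  imports
    "HOL-Probability.Probability"
    "HOL-Computational_Algebra.Polynomial"
begin

text \<open>
  The index type \<open>'n\<close> has \<open>n\<close> elements, so n-by-n real matrices are \<open>real^'n^'n\<close>;
  the modes \<open>S = {1,...,N}\<close> are the elements of a finite type \<open>'s\<close>.
\<close>

section \<open>Matrices\<close>

definition pos_semidefinite :: "real^'n^'n \<Rightarrow> bool" where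
  "pos_semidefinite X \<longleftrightarrow> transpose X = X \<and> (\<forall>v. 0 \<le> v \<bullet> (X *v v))"

definition neg_definite :: "real^'n^'n \<Rightarrow> bool" where
  "neg_definite X \<longleftrightarrow> transpose X = X \<and> (\<forall>v. v \<noteq> 0 \<longrightarrow> v \<bullet> (X *v v) < 0)"

definition hconcat :: "'a^'n^'k \<Rightarrow> 'a^'m^'k \<Rightarrow> 'a^('n + 'm)^'k" where
  "hconcat X Y = (\<chi> a b. case b of Inl j \<Rightarrow> X $ a $ j | Inr j \<Rightarrow> Y $ a $ j)"

text \<open>
  \<open>four_block I W X Y Z\<close> is the 2-by-2 block matrix with block rows \<open>(W X)\<close> and \<open>(Y Z)\<close>,
  where the indices in \<open>I\<close> form the first block and those in \<open>- I\<close> the second one.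
  As \<open>'n\<close> carries no order, \<open>I\<close> plays the role of the first \<open>card I\<close> indices; of each
  argument only the entries lying in the corresponding block matter.
\<close>

definition four_block ::
    "'n set \<Rightarrow> real^'n^'n \<Rightarrow> real^'n^'n \<Rightarrow> real^'n^'n \<Rightarrow> real^'n^'n \<Rightarrow> real^'n^'n" where
  "four_block I W X Y Z =
     (\<chi> a b. if a \<in> I then (if b \<in> I then W $ a $ b else X $ a $ b)
             else (if b \<in> I then Y $ a $ b else Z $ a $ b))"

definition nilpotent_mat :: "real^'n^'n \<Rightarrow> bool" where
  "nilpotent_mat X \<longleftrightarrow> (\<exists>k. (((**) X) ^^ k) (mat 1) = 0)"

definition pencil_det :: "real^'n^'n \<Rightarrow> real^'n^'n \<Rightarrow> real poly" where
  "pencil_det E A = det (\<chi> a b. [:- (A $ a $ b), E $ a $ b:])"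

section \<open>Causality\<close>

text \<open>
  The second diagonal block \<open>Z\<close> of \<open>M E N\<close> is nilpotent as a \<open>card (- I)\<close>-sized square matrix
  iff its extension by zero is nilpotent.
\<close>

definition causal_form_a :: "real^'n^'n \<Rightarrow> real^'n^'n \<Rightarrow> real^'n^'n \<Rightarrow>
    real^'n^'n \<Rightarrow> real^'n^'n \<Rightarrow> bool" where
  "causal_form_a E A C M N \<longleftrightarrow>
     (\<exists>I Nil A11 C11 C12.
        M ** E ** N = four_block I (mat 1) 0 0 Nil \<and>
        M ** A ** N = four_block I A11 0 0 (mat 1) \<and>
        M ** C ** N = four_block I C11 C12 0 0 \<and>
        nilpotent_mat (four_block I 0 0 0 Nil)) \<and>
     degree (pencil_det E A) = rank E"

definition causal_form_b :: "real^'n^'n \<Rightarrow> real^'n^'n \<Rightarrow> real^'n^'n \<Rightarrow>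
    real^'n^'n \<Rightarrow> real^'n^'n \<Rightarrow> bool" where
  "causal_form_b E A C M N \<longleftrightarrow>
     (\<exists>I A11 C11 C12 C22. card I = rank E \<and>
        M ** E ** N = four_block I (mat 1) 0 0 0 \<and>
        M ** A ** N = four_block I A11 0 0 (mat 1) \<and>
        M ** C ** N = four_block I C11 C12 0 C22)"

definition causal :: "real^'n^'n \<Rightarrow> ('s \<Rightarrow> real^'n^'n) \<Rightarrow> ('s \<Rightarrow> real^'n^'n) \<Rightarrow> bool" where
  "causal E A C \<longleftrightarrow>
     (\<forall>i. \<exists>M N. invertible M \<and> invertible N \<and>
        (causal_form_a E (A i) (C i) M N \<or> causal_form_b E (A i) (C i) M N))"

section \<open>Mode process and noise\<close>

definition transition_matrix :: "('s::finite \<Rightarrow> 's \<Rightarrow> real) \<Rightarrow> bool" where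
  "transition_matrix \<Lambda> \<longleftrightarrow> (\<forall>i j. 0 \<le> \<Lambda> i j) \<and> (\<forall>i. (\<Sum>j\<in>UNIV. \<Lambda> i j) = 1)"

definition markov_chain ::
    "'w measure \<Rightarrow> (nat \<Rightarrow> 'w \<Rightarrow> 's::finite) \<Rightarrow> ('s \<Rightarrow> 's \<Rightarrow> real) \<Rightarrow> bool" where
  "markov_chain M r \<Lambda> \<longleftrightarrow>
     transition_matrix \<Lambda> \<and>
     (\<forall>k. r k \<in> measurable M (count_space UNIV)) \<and>
     (\<forall>k s j. \<P>(\<omega> in M. \<forall>l\<le>k. r l \<omega> = s l) \<noteq> 0 \<longrightarrow>
        \<P>(\<omega> in M. r (Suc k) \<omega> = j \<bar> \<forall>l\<le>k. r l \<omega> = s l) = \<Lambda> (s k) j)"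

definition wide_stationary_noise :: "'w measure \<Rightarrow> (nat \<Rightarrow> 'w \<Rightarrow> real) \<Rightarrow> bool" where
  "wide_stationary_noise M w \<longleftrightarrow>
     (\<forall>k. w k \<in> borel_measurable M \<and> integrable M (\<lambda>\<omega>. (w k \<omega>)\<^sup>2) \<and>
        integral\<^sup>L M (w k) = 0) \<and>
     (\<forall>k s. integral\<^sup>L M (\<lambda>\<omega>. w k \<omega> * w s \<omega>) = (if k = s then 1 else 0))"

definition noise_history ::
    "'w measure \<Rightarrow> (nat \<Rightarrow> 'w \<Rightarrow> 's) \<Rightarrow> (nat \<Rightarrow> 'w \<Rightarrow> real) \<Rightarrow> nat \<Rightarrow> 'w measure" where
  "noise_history M r w k =
     sigma (space M)
       ({r l -` B \<inter> space M | l B. True} \<union>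
        {w s -` B \<inter> space M | s B. s < k \<and> B \<in> sets borel})"

text \<open>
  The moment equations of the system require that the mean 0 and the variance 1 of \<open>w k\<close>
  persist conditionally on the chain and on the earlier noise.  This holds in particular when
  the \<open>w k\<close> are mutually independent and independent of the chain.  Uncorrelatedness alone does
  not suffice: in the scalar case \<open>x (k+1) = c * x k * w k\<close> take \<open>w k = e k * V\<close> with independent
  fair signs \<open>e k\<close> and, independent of them, \<open>V^2\<close> equal to 2 or 0 with probability 1/2 each; then
  \<open>E (x k)^2 = (2*c^2)^k * x0^2 / 2\<close> for \<open>k \<ge> 1\<close>, which does not
  tend to 0 for \<open>1/2 \<le> c^2 < 1\<close>, \<open>x0 \<noteq> 0\<close>, although \<open>c^2 < 1\<close> makes the matrix inequalities
  solvable.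
\<close>

definition conditionally_white_noise ::
    "'w measure \<Rightarrow> (nat \<Rightarrow> 'w \<Rightarrow> 's) \<Rightarrow> (nat \<Rightarrow> 'w \<Rightarrow> real) \<Rightarrow> bool" where
  "conditionally_white_noise M r w \<longleftrightarrow>
     (\<forall>k. (AE \<omega> in M. real_cond_exp M (noise_history M r w k) (w k) \<omega> = 0) \<and>
          (AE \<omega> in M. real_cond_exp M (noise_history M r w k) (\<lambda>\<omega>. (w k \<omega>)\<^sup>2) \<omega> = 1))"

section \<open>Solutions and mean square admissibility\<close>

text \<open>
  As usual for singular systems the initial condition is imposed through \<open>E\<close>: for singular \<open>E\<close> the
  system contains algebraic equations, which an arbitrary \<open>x0\<close> need not satisfy, so that
  \<open>x 0 = x0\<close> itself could not be met for all \<open>x0\<close> (for \<open>E = 0\<close>, \<open>A = I\<close>, \<open>C = 0\<close> it forces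
  \<open>x0 = 0\<close>).  Every process with \<open>x 0 = x0\<close> that satisfies the recursion is a solution in this
  sense; for invertible \<open>E\<close> the two conditions coincide.
\<close>

definition solution :: "'w measure \<Rightarrow> (nat \<Rightarrow> 'w \<Rightarrow> 's) \<Rightarrow> (nat \<Rightarrow> 'w \<Rightarrow> real) \<Rightarrow>
    real^'n^'n \<Rightarrow> ('s \<Rightarrow> real^'n^'n) \<Rightarrow> ('s \<Rightarrow> real^'n^'n) \<Rightarrow> real^'n \<Rightarrow>
    (nat \<Rightarrow> 'w \<Rightarrow> real^'n) \<Rightarrow> bool" where
  "solution M r w E A C x0 x \<longleftrightarrow>
     (\<forall>k. x k \<in> borel_measurable M) \<and>
     (AE \<omega> in M. E *v x 0 \<omega> = E *v x0) \<and>
     (AE \<omega> in M. \<forall>k. E *v x (Suc k) \<omega> =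
        A (r k \<omega>) *v x k \<omega> + w k \<omega> *\<^sub>R (C (r k \<omega>) *v x k \<omega>))"

definition has_unique_solution :: "'w measure \<Rightarrow> (nat \<Rightarrow> 'w \<Rightarrow> 's) \<Rightarrow> (nat \<Rightarrow> 'w \<Rightarrow> real) \<Rightarrow>
    real^'n^'n \<Rightarrow> ('s \<Rightarrow> real^'n^'n) \<Rightarrow> ('s \<Rightarrow> real^'n^'n) \<Rightarrow> bool" where
  "has_unique_solution M r w E A C \<longleftrightarrow>
     (\<forall>x0. (\<exists>x. solution M r w E A C x0 x) \<and>
        (\<forall>x y. solution M r w E A C x0 x \<and> solution M r w E A C x0 y \<longrightarrow>
           (AE \<omega> in M. \<forall>k. x k \<omega> = y k \<omega>)))"

text \<open>
  As \<open>x0\<close> is deterministic, conditioning on \<open>x0\<close> and \<open>r 0\<close> is conditioning on \<open>r 0\<close>.  The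
  conditional expectation takes values in \<open>ennreal\<close>, so no second moment is taken to be finite
  in advance.
\<close>

definition cond_second_moment :: "'w measure \<Rightarrow> (nat \<Rightarrow> 'w \<Rightarrow> 's) \<Rightarrow> ('w \<Rightarrow> real^'n) \<Rightarrow>
    'w \<Rightarrow> ennreal" where
  "cond_second_moment M r y =
     nn_cond_exp M (vimage_algebra (space M) (r 0) (count_space UNIV))
       (\<lambda>\<omega>. ennreal ((norm (y \<omega>))\<^sup>2))"

definition asymptotically_stable_ms :: "'w measure \<Rightarrow> (nat \<Rightarrow> 'w \<Rightarrow> 's) \<Rightarrow>
    (nat \<Rightarrow> 'w \<Rightarrow> real) \<Rightarrow> real^'n^'n \<Rightarrow> ('s \<Rightarrow> real^'n^'n) \<Rightarrow> ('s \<Rightarrow> real^'n^'n) \<Rightarrow> bool" where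
  "asymptotically_stable_ms M r w E A C \<longleftrightarrow>
     has_unique_solution M r w E A C \<and>
     (\<forall>x0 x. solution M r w E A C x0 x \<longrightarrow>
        (AE \<omega> in M. (\<lambda>k. cond_second_moment M r (x k) \<omega>) \<longlonglongrightarrow> 0))"

definition mean_square_admissible :: "'w measure \<Rightarrow> (nat \<Rightarrow> 'w \<Rightarrow> 's) \<Rightarrow>
    (nat \<Rightarrow> 'w \<Rightarrow> real) \<Rightarrow> real^'n^'n \<Rightarrow> ('s \<Rightarrow> real^'n^'n) \<Rightarrow> ('s \<Rightarrow> real^'n^'n) \<Rightarrow> bool" where
  "mean_square_admissible M r w E A C \<longleftrightarrow>
     has_unique_solution M r w E A C \<and> causal E A C \<and> asymptotically_stable_ms M r w E A C"

end

theory Submission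
  imports Defs
begin

text \<open>
  Because \<open>C i\<close> maps into the range of \<open>E\<close>, its contribution to the matrix inequality is nonnegative.
  Hence \<open>(A v)\<^sup>T X (A v) < 0\<close> for nonzero \<open>v\<close> in the kernel of \<open>E\<close>, which excludes
  \<open>A v = E u\<close>: every pencil \<open>(E, A i)\<close> has index at most one.  This yields the canonical form (b)
  and a linear left inverse \<open>F i\<close> of \<open>E\<close> on the consistent vectors of mode \<open>i\<close>.  A solution is then
  \<open>x k = F (r k) (y k)\<close>, where \<open>y = E x\<close> obeys the explicit recursion
  \<open>y (k+1) = A (r k) F (r k) (y k) + w k C (r k) F (r k) (y k)\<close>.

  Conditionally on the mode path, second moments of \<open>y k\<close> depend on the first \<open>k\<close> modes only, so the
  Markov property gives the Lyapunov decrease: from step \<open>k\<close> to \<open>k+1\<close> the expectation of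
  \<open>(y k)\<^sup>T P (r k) (y k) \<ge> 0\<close> drops by at least \<open>\<alpha>\<close> times that of \<open>\<bar>x k\<bar>\<^sup>2\<close>.  Thus the second
  moments of \<open>x k\<close> are summable, and so are, almost surely, the conditional ones given \<open>r 0\<close>.
\<close>

section \<open>Pencils of index at most one\<close>

text \<open>The columns of \<open>E\<close> are among those of \<open>[E C]\<close>. Equal rank
  forces equal column spans, so the columns of \<open>C\<close> fall into the range of
  \<open>E\<close>.\<close>

lemma range_subset_of_rank_hconcat:
  fixes E C :: "real^'n^'n"
  assumes "rank (hconcat E C) = rank E"
  shows "\<exists>u. C *v v = E *v u"
proof -
  have cE: "column j E = column (Inl j) (hconcat E C)" and cC: "column j C = column (Inr j) (hconcat E C)" for j
    by (simp_all add: column_def hconcat_def vec_eq_iff)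
  have sub: "columns E \<subseteq> columns (hconcat E C)" "columns C \<subseteq> columns (hconcat E C)"
    unfolding columns_def using cE cC by blast+
  have "span (columns E) = span (columns (hconcat E C))"
    using dim_eq_span[OF sub(1)] assms by (simp add: column_rank_def)
  then have "C *v v \<in> span (columns E)"
    using matrix_vector_mult_in_columnspace[of C v] span_mono[OF sub(2)] by auto
  also have "columns E \<subseteq> range ((*v) E)"
    by (auto simp: columns_image_basis)
  then have "span (columns E) \<subseteq> range ((*v) E)"
    by (intro span_minimal) (auto intro: linear_subspace_image)
  finally show ?thesis by auto
qed

text \<open>The quadratic form attains its maximum on the compact unit sphere, where it is negative;
  homogeneity of degree two carries the bound to every vector.\<close>

lemma neg_definite_coercive:
  fixes L :: "real^'n^'n"
  assumes "neg_definite L"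
  obtains \<alpha> where "\<alpha> > 0" "\<And>v. v \<bullet> (L *v v) \<le> - \<alpha> * (norm v)\<^sup>2"
proof -
  have "continuous_on (sphere 0 1) (\<lambda>v. v \<bullet> (L *v v))"
    by (intro continuous_intros matrix_vector_mult_linear_continuous_on)
  moreover have "sphere (0::real^'n) 1 \<noteq> {}"
    by simp
  ultimately obtain u :: "real^'n" where u: "u \<in> sphere 0 1"
      "\<And>v. v \<in> sphere 0 1 \<Longrightarrow> v \<bullet> (L *v v) \<le> u \<bullet> (L *v u)"
    using continuous_attains_sup[OF compact_sphere] by blast
  have "u \<noteq> 0" using u(1) by auto
  define \<alpha> where "\<alpha> = - (u \<bullet> (L *v u))"
  have "\<alpha> > 0"
    using assms \<open>u \<noteq> 0\<close> by (simp add: neg_definite_def \<alpha>_def)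
  moreover have "v \<bullet> (L *v v) \<le> - \<alpha> * (norm v)\<^sup>2" for v
  proof (cases "v = 0")
    case False
    define c where "c = norm v"
    define e where "e = (1 / c) *\<^sub>R v"
    have c: "c > 0" and v: "v = c *\<^sub>R e" and "e \<in> sphere 0 1"
      using False by (simp_all add: c_def e_def)
    have "v \<bullet> (L *v v) = c\<^sup>2 * (e \<bullet> (L *v e))"
      unfolding v by (simp add: matrix_vector_mult_scaleR power2_eq_square)
    also have "\<dots> \<le> c\<^sup>2 * - \<alpha>"
      using u(2)[OF \<open>e \<in> sphere 0 1\<close>] by (intro mult_left_mono) (auto simp: \<alpha>_def)
    finally show ?thesis by (simp add: c_def mult.commute)
  qed simp
  ultimately show ?thesis using that by blast
qed

section \<open>Decomposition induced by a pencil and its canonical form\<close>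

lemma column_matrix_mult:
  "column b (X ** Y) = X *v column b (Y :: real^'n^'n)"
  by (simp add: column_def matrix_matrix_mult_def matrix_vector_mult_def vec_eq_iff)

lemma matrix_eq_columns:
  assumes "\<And>b. column b X = column b Y"
  shows "X = (Y :: real^'n^'n)"
  using assms by (simp add: column_def vec_eq_iff)

text \<open>A coordinate-free way to say that the pencil \<open>(E, A)\<close> is regular of index
  at most one: no nonzero vector of the kernel of \<open>E\<close> is sent by \<open>A\<close> into
  the range of \<open>E\<close>.\<close>

locale index_one_pencil =
  fixes E A :: "real^'n^'n"
  assumes index_one: "E *v v = 0 \<Longrightarrow> A *v v = E *v u \<Longrightarrow> v = 0"
begin

text \<open>These are the vectors that meet the algebraic constraints, that is, those from which the
  noise-free equation has a successor.\<close>

definition consistent :: "(real^'n) set" where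
  "consistent = {v. \<exists>u. A *v v = E *v u}"

definition null_space :: "(real^'n) set" where
  "null_space = {v. E *v v = 0}"

lemma subspace_null_space: "subspace null_space"
  by (auto simp: null_space_def subspace_def matrix_vector_right_distrib matrix_vector_mult_scaleR)

lemma subspace_consistent: "subspace consistent"
proof -
  have "consistent = (*v) A -` range ((*v) E)"
    by (auto simp: consistent_def)
  then show ?thesis
    by (auto intro!: linear_subspace_vimage linear_subspace_image)
qed

lemma null_space_Int_consistent: "v \<in> null_space \<Longrightarrow> v \<in> consistent \<Longrightarrow> v = 0"
  using index_one by (auto simp: null_space_def consistent_def)

text \<open>Let \<open>g\<close> be a linear projection onto the kernel of \<open>E\<close>. The
  index condition makes the map \<open>v\<close> to \<open>E v + A (g v)\<close> injective, hence
  onto by finite dimension.\<close>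

lemma range_sum_image_null_space: "\<exists>u k. y = E *v u + A *v k \<and> k \<in> null_space"
proof -
  obtain g where g: "range g \<subseteq> null_space" "linear g" "\<And>v. v \<in> null_space \<Longrightarrow> g v = v"
    using linear_exists_left_inverse_on[of "\<lambda>v. v" null_space] subspace_null_space by (auto simp: linear_id[unfolded id_def])
  define S where "S v = E *v v + A *v g v" for v
  have linS: "linear S"
    unfolding S_def
    by (intro linear_compose_add linear_compose[OF g(2), unfolded o_def]) auto
  have "inj S"
  proof (rule linear_injective_0[OF linS, THEN iffD2], intro allI impI)
    fix v assume "S v = 0"
    then have 1: "A *v g v = E *v (- v)"
      by (simp add: S_def eq_neg_iff_add_eq_0 add.commute linear_neg[OF matrix_vector_mul_linear])
    have "g v \<in> null_space" using g(1) by auto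
    then have "g v = 0" using index_one[OF _ 1] by (auto simp: null_space_def)
    then have "v \<in> null_space" using \<open>S v = 0\<close> by (auto simp: null_space_def S_def)
    then show "v = 0" using g(3) \<open>g v = 0\<close> by auto
  qed
  then obtain u where "S u = y"
    using linear_injective_imp_surjective[OF linS] by (metis surjD)
  then have "y = E *v u + A *v g u" by (simp add: S_def)
  then show ?thesis using g(1) by blast
qed

text \<open>Writing \<open>A v = E u + A k\<close> with \<open>k\<close> in the kernel of
  \<open>E\<close> shows that \<open>v - k\<close> is consistent. Together with the trivial
  intersection this splits the whole space as a direct sum.\<close>

lemma consistent_sum_null_space: "\<exists>v' k. v = v' + k \<and> v' \<in> consistent \<and> k \<in> null_space"
proof -
  obtain u k where "A *v v = E *v u + A *v k" "k \<in> null_space"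
    using range_sum_image_null_space by blast
  then have "v - k \<in> consistent"
    by (auto simp: consistent_def matrix_vector_mult_diff_distrib)
  then show ?thesis using \<open>k \<in> null_space\<close> by (metis diff_add_cancel)
qed

lemma inj_on_consistent: "inj_on ((*v) E) consistent"
proof (rule inj_onI)
  fix u v assume "u \<in> consistent" "v \<in> consistent" "E *v u = E *v v"
  then have "u - v \<in> null_space" "u - v \<in> consistent"
    using subspace_consistent by (auto simp: null_space_def matrix_vector_mult_diff_distrib subspace_diff)
  then show "u = v" using null_space_Int_consistent by fastforce
qed

lemma image_consistent: "(*v) E ` consistent = range ((*v) E)"
proof -
  have "E *v v \<in> (*v) E ` consistent" for v
  proof -
    obtain v' k where "v = v' + k" "v' \<in> consistent" "k \<in> null_space"
      using consistent_sum_null_space by blast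
    then show ?thesis by (auto simp: null_space_def matrix_vector_right_distrib)
  qed
  then show ?thesis by auto
qed

text \<open>By the direct sum, \<open>E\<close> maps the consistent vectors bijectively onto its
  range. \<open>F\<close> is a linear extension of the inverse bijection whose values stay
  consistent; it recovers a consistent state from its image under \<open>E\<close>.\<close>

lemma ex_consistent_inverse:
  obtains F where "\<And>y. F *v y \<in> consistent" "\<And>v. v \<in> consistent \<Longrightarrow> F *v (E *v v) = v"
    "\<And>v. E *v (F *v (E *v v)) = E *v v"
proof -
  obtain g where g: "range g \<subseteq> consistent" "linear g" "\<And>v. v \<in> consistent \<Longrightarrow> g (E *v v) = v"
    using linear_exists_left_inverse_on[OF _ subspace_consistent inj_on_consistent] by auto
  have g': "matrix g *v y = g y" for y
    using g(2) by (simp add: matrix_works)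
  show ?thesis
  proof (rule that[of "matrix g"])
    fix v
    obtain u where "E *v v = E *v u" "u \<in> consistent"
      using image_consistent by (metis imageE rangeI)
    then show "E *v (matrix g *v (E *v v)) = E *v v"
      using g(3) g' by metis
  qed (use g g' in auto)
qed

text \<open>The columns of \<open>N\<close> form a basis adapted to the direct sum, and
  \<open>Q\<close> inverts the matrix of their images, taken under \<open>E\<close> on the
  consistent part and under \<open>A\<close> on the kernel. The last conclusion confines the range
  of \<open>E\<close> to the first block; it is what later fixes the shape of the noise
  matrix.\<close>

theorem weierstrass_form:
  obtains Q N A11 :: "real^'n^'n" and I where "invertible Q" "invertible N" "card I = rank E"
    "Q ** E ** N = four_block I (mat 1) 0 0 0"
    "Q ** A ** N = four_block I A11 0 0 (mat 1)"
    "\<And>y a. a \<notin> I \<Longrightarrow> (Q *v (E *v y)) $ a = 0"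
proof -
  obtain B1 where B1: "B1 \<subseteq> consistent" "independent B1" "consistent \<subseteq> span B1" "card B1 = dim consistent"
    using basis_exists by blast
  obtain B2 where B2: "B2 \<subseteq> null_space" "independent B2" "null_space \<subseteq> span B2" "card B2 = dim null_space"
    using basis_exists by blast
  have span1: "span B1 = consistent" and span2: "span B2 = null_space"
    using B1 B2 span_minimal[OF B1(1) subspace_consistent] span_minimal[OF B2(1) subspace_null_space] by auto
  have fin: "finite B1" "finite B2"
    using B1(2) B2(2) independent_imp_finite by auto
  have disj: "B1 \<inter> B2 = {}"
    using B1(1,2) B2(1) null_space_Int_consistent dependent_zero by blast
  have "v \<in> span (B1 \<union> B2)" for v
    using consistent_sum_null_space[of v] by (auto simp: span_Un span1 span2)
  then have spanU: "span (B1 \<union> B2) = UNIV" by auto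
  \<comment> \<open>The dimensions of the two summands add up to the number of indices, so the
    adapted basis can be indexed by \<open>'n\<close>; \<open>I\<close> will mark the consistent
    basis vectors.\<close>
  have "DIM(real^'n) = dim {x + y |x y. x \<in> consistent \<and> y \<in> null_space}"
  proof -
    have "{x + y |x y. x \<in> consistent \<and> y \<in> null_space} = UNIV"
      using consistent_sum_null_space by blast
    then show ?thesis by simp
  qed
  also have "\<dots> = dim consistent + dim null_space"
  proof -
    have "consistent \<inter> null_space = {0}"
      using null_space_Int_consistent subspace_0[OF subspace_null_space] subspace_0[OF subspace_consistent] by auto
    then show ?thesis
      using dim_sums_Int[OF subspace_consistent subspace_null_space] by simp
  qed
  finally have "card (UNIV::'n set) = card (B1 \<union> B2)"
    using B1(4) B2(4) disj fin by (simp add: card_Un_disjoint)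
  then obtain f :: "'n \<Rightarrow> real^'n" where f: "bij_betw f UNIV (B1 \<union> B2)"
    using finite_same_card_bij[of "UNIV::'n set" "B1 \<union> B2"] fin by auto
  define I where "I = f -` B1"
  have ran: "range f = B1 \<union> B2" and injf: "inj f"
    using f by (auto simp: bij_betw_def)
  have fI: "f ` I = B1"
    using ran by (auto simp: I_def)
  have fI': "f ` (- I) = B2"
    using ran disj by (simp add: I_def flip: vimage_Compl) (auto simp: image_vimage_eq)
  have in1: "f b \<in> consistent" if "b \<in> I" for b
    using that B1(1) by (auto simp: I_def)
  have in2: "E *v f b = 0" if "b \<notin> I" for b
    using that B2(1) fI' by (auto simp: null_space_def)
  have "card I = card B1"
    using fI card_image[of f I] injf by (metis inj_on_subset subset_UNIV)
  also have "\<dots> = dim ((*v) E ` consistent)"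
    using B1(4) dim_image_eq[of "(*v) E" consistent] inj_on_consistent subspace_consistent
    by (simp add: span_eq_iff[THEN iffD2])
  finally have cardI: "card I = rank E"
    by (simp add: rank_dim_range image_consistent)
  \<comment> \<open>The columns of \<open>R\<close> span the range of \<open>E\<close> together with
    the image of its kernel under \<open>A\<close>, hence everything. So \<open>R\<close> is
    invertible, and \<open>Q\<close> is its inverse.\<close>
  define N where "N = (\<chi> a b. f b $ a)"
  define R where "R = (\<chi> a b. (if b \<in> I then E *v f b else A *v f b) $ a)"
  have colN: "column b N = f b" for b
    by (simp add: column_def N_def)
  have colR: "column b R = (if b \<in> I then E *v f b else A *v f b)" for b
    by (simp add: column_def R_def)
  have "columns N = B1 \<union> B2"
    unfolding columns_def colN using ran by auto
  then have "\<exists>B. N ** B = mat 1"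
    using spanU by (simp add: matrix_right_invertible_span_columns span_vec_eq)
  then have invN: "invertible N"
    by (simp add: invertible_right_inverse)
  have colsR: "columns R = (*v) E ` B1 \<union> (*v) A ` B2"
    unfolding columns_def colR fI[symmetric] fI'[symmetric] by auto
  have spanE: "span ((*v) E ` B1) = range ((*v) E)"
    using span1 image_consistent by (simp add: linear_span_image)
  have "y \<in> span (columns R)" for y
  proof -
    obtain u k where "y = E *v u + A *v k" "k \<in> null_space"
      using range_sum_image_null_space by blast
    then show ?thesis
      unfolding colsR span_Un spanE using span2 by (auto simp: linear_span_image)
  qed
  then have "\<exists>B. R ** B = mat 1"
    by (auto simp: matrix_right_invertible_span_columns span_vec_eq)
  then have "invertible R"
    by (simp add: invertible_right_inverse)
  then obtain Q where Q: "Q ** R = mat 1" "R ** Q = mat 1"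
    by (auto simp: invertible_def)
  have invQ: "invertible Q"
    using Q by (auto simp: invertible_def)
  have "Q *v column b R = column b (mat 1)" for b
    by (simp flip: column_matrix_mult add: Q)
  then have QE: "b \<in> I \<Longrightarrow> Q *v (E *v f b) = column b (mat 1)"
    and QA: "b \<notin> I \<Longrightarrow> Q *v (A *v f b) = column b (mat 1)" for b
    by (metis colR)+
  \<comment> \<open>The range of \<open>E\<close> is spanned by the vectors \<open>E (f b)\<close>
    with \<open>b\<close> in \<open>I\<close>, and \<open>Q\<close> turns these into unit vectors
    with index in \<open>I\<close>.\<close>
  have zero: "(Q *v (E *v y)) $ a = 0" if "a \<notin> I" for y a
  proof -
    have "E *v y \<in> span ((*v) E ` B1)"
      by (simp add: spanE)
    moreover have "span ((*v) E ` B1) \<subseteq> {z. (Q *v z) $ a = 0}"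
    proof (rule span_minimal)
      have "(Q *v (E *v f b)) $ a = 0" if "b \<in> I" for b
        using QE[OF that] that \<open>a \<notin> I\<close> by (auto simp: column_def mat_def)
      then show "(*v) E ` B1 \<subseteq> {z. (Q *v z) $ a = 0}"
        using fI by auto
    qed (auto simp: subspace_def matrix_vector_right_distrib matrix_vector_mult_scaleR)
    ultimately show ?thesis by auto
  qed
  have cE: "column b (Q ** E ** N) = Q *v (E *v f b)" and cA: "column b (Q ** A ** N) = Q *v (A *v f b)" for b
    by (simp_all add: column_matrix_mult colN matrix_vector_mul_assoc)
  show ?thesis
  proof (rule that[of Q N I "Q ** A ** N"])
    show "Q ** E ** N = four_block I (mat 1) 0 0 0"
    proof (rule matrix_eq_columns)
      fix b show "column b (Q ** E ** N) = column b (four_block I (mat 1) 0 0 0)"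
      proof (cases "b \<in> I")
        case True
        then show ?thesis
          unfolding cE QE[OF True] by (auto simp: column_def four_block_def mat_def vec_eq_iff)
      next
        case False
        then show ?thesis
          unfolding cE in2[OF False] by (auto simp: column_def four_block_def vec_eq_iff)
      qed
    qed
    show "Q ** A ** N = four_block I (Q ** A ** N) 0 0 (mat 1)"
    proof (rule matrix_eq_columns)
      fix b
      show "column b (Q ** A ** N) = column b (four_block I (Q ** A ** N) 0 0 (mat 1))"
      proof (cases "b \<in> I")
        case True
        then obtain u where "A *v f b = E *v u" using in1 by (auto simp: consistent_def)
        then have "column b (Q ** A ** N) $ a = 0" if "a \<notin> I" for a
          using zero that by (simp add: cA)
        then show ?thesis
          using True by (auto simp: column_def four_block_def vec_eq_iff)
      next
        case False
        then have "column b (Q ** A ** N) = column b (mat 1)"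
          using QA by (simp add: cA)
        then show ?thesis
          using False by (auto simp: column_def four_block_def mat_def vec_eq_iff)
      qed
    qed
  qed (use invQ invN cardI zero in auto)
qed

text \<open>As \<open>C\<close> maps into the range of \<open>E\<close>, all rows of
  \<open>Q C N\<close> outside \<open>I\<close> vanish. In particular its lower left block is zero,
  as form (b) demands.\<close>

lemma causal_form:
  fixes C :: "real^'n^'n"
  assumes "\<And>v. \<exists>u. C *v v = E *v u"
  shows "\<exists>Q N. invertible Q \<and> invertible N \<and> causal_form_b E A C Q N"
proof -
  obtain Q N A11 :: "real^'n^'n" and I where *: "invertible Q" "invertible N" "card I = rank E"
    "Q ** E ** N = four_block I (mat 1) 0 0 0"
    "Q ** A ** N = four_block I A11 0 0 (mat 1)"
    "\<And>y a. a \<notin> I \<Longrightarrow> (Q *v (E *v y)) $ a = 0"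
    using weierstrass_form by metis
  let ?C = "Q ** C ** N"
  have "column b ?C = Q *v (C *v column b N)" for b
    by (simp only: column_matrix_mult matrix_vector_mul_assoc)
  then have "column b ?C $ a = 0" if "a \<notin> I" for a b
    using assms[of "column b N"] *(6)[OF that] by auto
  then have "?C = four_block I ?C ?C 0 ?C"
    by (auto simp: four_block_def vec_eq_iff column_def)
  then show ?thesis
    using * unfolding causal_form_b_def by blast
qed

end

section \<open>Linear jump systems driven by conditionally white noise\<close>

lemma matrix_family_bound:
  fixes B :: "'s::finite \<Rightarrow> real^'n^'m"
  obtains K where "K \<ge> 0" "\<And>i v. norm (B i *v v) \<le> K * norm v"
proof (rule that)
  define K where "K = (\<Sum>i\<in>UNIV. onorm ((*v) (B i)))"
  have nonneg: "0 \<le> onorm ((*v) (B i))" for i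
    by (simp add: onorm_pos_le matrix_vector_mul_bounded_linear)
  then show "K \<ge> 0" unfolding K_def by (intro sum_nonneg) auto
  fix i v
  have "norm (B i *v v) \<le> onorm ((*v) (B i)) * norm v"
    by (rule onorm[OF matrix_vector_mul_bounded_linear])
  also have "\<dots> \<le> K * norm v"
    unfolding K_def by (intro mult_right_mono member_le_sum nonneg) auto
  finally show "norm (B i *v v) \<le> K * norm v" .
qed

lemma inner_transpose_vector_mult:
  fixes B :: "real^'n^'m"
  shows "v \<bullet> (transpose B *v u) = (B *v v) \<bullet> u"
  by (metis dot_lmul_matrix inner_commute transpose_matrix_vector)

lemma sum_matrix_vector_mult:
  fixes f :: "'a \<Rightarrow> real^'n^'m"
  shows "sum f S *v v = (\<Sum>j\<in>S. f j *v v)"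
  by (induction S rule: infinite_finite_induct) (auto simp: matrix_vector_mult_add_rdistrib)

lemma borel_measurable_matrix_vector_mult [measurable (raw)]:
  fixes Q :: "real^'n^'m"
  assumes "f \<in> borel_measurable N"
  shows "(\<lambda>\<omega>. Q *v f \<omega>) \<in> borel_measurable N"
proof -
  have "((*v) Q) \<in> borel_measurable borel"
    by (intro borel_measurable_continuous_onI matrix_vector_mult_linear_continuous_on)
  then show ?thesis
    using measurable_compose[OF assms] by blast
qed

lemma borel_measurable_random_matrix_vector_mult:
  fixes B :: "'s::finite \<Rightarrow> real^'n^'m"
  assumes "g \<in> measurable N (count_space UNIV)" and "f \<in> borel_measurable N"
  shows "(\<lambda>\<omega>. B (g \<omega>) *v f \<omega>) \<in> borel_measurable N"
  by (rule measurable_compose_countable[where f = "\<lambda>i \<omega>. B i *v f \<omega>", OF _ assms(1)])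
    (intro borel_measurable_matrix_vector_mult assms(2))

text \<open>An explicit, nonsingular recursion. The singular system enters later with
  \<open>B = A F\<close>, \<open>D = C F\<close> and \<open>y0 = E x0\<close>, so that the state
  stands for \<open>E x\<close>.\<close>

locale white_noise_jump_system = prob_space M for M :: "'w measure" +
  fixes r :: "nat \<Rightarrow> 'w \<Rightarrow> 's::finite"
    and w :: "nat \<Rightarrow> 'w \<Rightarrow> real"
    and \<Lambda> :: "'s \<Rightarrow> 's \<Rightarrow> real"
    and B D :: "'s \<Rightarrow> real^'n^'n"
    and y0 :: "real^'n"
  assumes chain: "markov_chain M r \<Lambda>"
    and noise: "wide_stationary_noise M w"
    and white: "conditionally_white_noise M r w"
begin

primrec state :: "nat \<Rightarrow> 'w \<Rightarrow> real^'n" where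
  "state 0 \<omega> = y0"
| "state (Suc k) \<omega> = B (r k \<omega>) *v state k \<omega> + w k \<omega> *\<^sub>R (D (r k \<omega>) *v state k \<omega>)"

text \<open>This sigma-algebra contains the entire mode sequence, future included, but the noise
  only before step \<open>k\<close>. Thus \<open>state k\<close> and all indicators of mode paths
  are measurable for it, while \<open>w k\<close> is conditionally white.\<close>

abbreviation "H k \<equiv> noise_history M r w k"

section \<open>Measurability with respect to the history and moments against the noise\<close>

lemma measurable_mode [measurable]: "r l \<in> measurable M (count_space UNIV)"
  using chain by (auto simp: markov_chain_def)

lemma measurable_noise [measurable]: "w l \<in> borel_measurable M"
  using noise by (auto simp: wide_stationary_noise_def)

lemma space_history: "space (H k) = space M"
  unfolding noise_history_def by (rule space_measure_of) auto

lemma sets_history: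
  "sets (H k) = sigma_sets (space M)
       ({r l -` B \<inter> space M | l B. True} \<union>
        {w s -` B \<inter> space M | s B. s < k \<and> B \<in> sets borel})"
  unfolding noise_history_def by (rule sets_measure_of) auto

lemma subalgebra_history: "subalgebra M (H k)"
  unfolding subalgebra_def sets_history space_history
  by (intro conjI refl sets.sigma_sets_subset) (auto intro: measurable_sets)

lemma measurable_mode_history [measurable]: "r l \<in> measurable (H k) (count_space UNIV)"
  by (rule measurableI) (auto simp: sets_history space_history intro!: sigma_sets.Basic)

lemma measurable_noise_history [measurable]: "s < k \<Longrightarrow> w s \<in> borel_measurable (H k)"
  by (rule measurableI) (auto simp: sets_history space_history intro!: sigma_sets.Basic)

lemma measurable_state_history: "k \<le> m \<Longrightarrow> state k \<in> borel_measurable (H m)"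
proof (induction k)
  case (Suc k)
  then have [measurable]: "state k \<in> borel_measurable (H m)" "w k \<in> borel_measurable (H m)"
    by (auto intro: measurable_noise_history)
  show ?case
    unfolding state.simps
    by (intro borel_measurable_add borel_measurable_scaleR borel_measurable_random_matrix_vector_mult)
      measurable
qed (simp add: state.simps(1)[abs_def])

lemma measurable_state [measurable]: "state k \<in> borel_measurable M"
  using measurable_from_subalg[OF subalgebra_history measurable_state_history] by blast

text \<open>The known factor \<open>f\<close> comes out of the conditional expectation, leaving the
  conditional variance 1 or mean 0 of \<open>w k\<close>. Integrability of the product has to be
  settled first, through nonnegative conditional expectations.\<close>

lemma
  assumes f [measurable]: "f \<in> borel_measurable (H k)" and int: "integrable M f"
  shows integrable_noise_square: "integrable M (\<lambda>\<omega>. f \<omega> * (w k \<omega>)\<^sup>2)"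
    and integral_noise_square: "(\<integral>\<omega>. f \<omega> * (w k \<omega>)\<^sup>2 \<partial>M) = (\<integral>\<omega>. f \<omega> \<partial>M)"
    and integrable_noise: "integrable M (\<lambda>\<omega>. f \<omega> * w k \<omega>)"
    and integral_noise: "(\<integral>\<omega>. f \<omega> * w k \<omega> \<partial>M) = 0"
proof -
  interpret S: finite_measure_subalgebra M "H k"
    by unfold_locales (rule subalgebra_history)
  have [measurable]: "f \<in> borel_measurable M"
    using int by auto
  \<comment> \<open>\<open>real_cond_exp\<close> is the difference of the real parts of
    \<open>?p\<close> and \<open>?q\<close>. The latter vanishes almost everywhere, so the white
    noise condition speaks about \<open>?p\<close> alone.\<close>
  let ?p = "nn_cond_exp M (H k) (\<lambda>\<omega>. ennreal ((w k \<omega>)\<^sup>2))"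
  let ?q = "nn_cond_exp M (H k) (\<lambda>\<omega>. ennreal (- (w k \<omega>)\<^sup>2))"
  have "(\<lambda>\<omega>. ennreal (- (w k \<omega>)\<^sup>2)) = (\<lambda>_. 0)"
    by (auto simp: ennreal_neg)
  then have "AE \<omega> in M. ?q \<omega> = 0"
    using S.nn_cond_exp_F_meas[of "\<lambda>_. 0"] by simp
  moreover have sq: "AE \<omega> in M. real_cond_exp M (H k) (\<lambda>\<omega>. (w k \<omega>)\<^sup>2) \<omega> = 1"
    using white by (auto simp: conditionally_white_noise_def)
  ultimately have p: "AE \<omega> in M. ?p \<omega> = 1"
  proof eventually_elim
    case (elim \<omega>)
    then have "enn2real (?p \<omega>) = 1" by (simp add: real_cond_exp_def)
    \<comment> \<open>The value infinity is excluded because \<open>enn2real\<close> sends it to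
      0.\<close>
    then show "?p \<omega> = 1" by (cases "?p \<omega>") auto
  qed
  have "(\<integral>\<^sup>+ \<omega>. ennreal (norm (f \<omega> * (w k \<omega>)\<^sup>2)) \<partial>M) = (\<integral>\<^sup>+ \<omega>. ennreal \<bar>f \<omega>\<bar> * ennreal ((w k \<omega>)\<^sup>2) \<partial>M)"
    by (simp add: abs_mult ennreal_mult)
  also have "\<dots> = (\<integral>\<^sup>+ \<omega>. ennreal \<bar>f \<omega>\<bar> * ?p \<omega> \<partial>M)"
    by (rule S.nn_cond_exp_intg[symmetric]) measurable
  also have "\<dots> = (\<integral>\<^sup>+ \<omega>. ennreal (norm (f \<omega>)) \<partial>M)"
    using p by (intro nn_integral_cong_AE) auto
  also have "\<dots> < \<infinity>"
    using int by (simp add: integrable_iff_bounded)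
  finally show 1: "integrable M (\<lambda>\<omega>. f \<omega> * (w k \<omega>)\<^sup>2)"
    by (intro integrableI_bounded) measurable
  have "(\<integral>\<omega>. f \<omega> * (w k \<omega>)\<^sup>2 \<partial>M) = (\<integral>\<omega>. f \<omega> * real_cond_exp M (H k) (\<lambda>\<omega>. (w k \<omega>)\<^sup>2) \<omega> \<partial>M)"
    by (rule S.real_cond_exp_intg(2)[OF 1, symmetric]) measurable
  also have "\<dots> = (\<integral>\<omega>. f \<omega> \<partial>M)"
    using sq by (intro integral_cong_AE) auto
  finally show "(\<integral>\<omega>. f \<omega> * (w k \<omega>)\<^sup>2 \<partial>M) = (\<integral>\<omega>. f \<omega> \<partial>M)" .
  show 2: "integrable M (\<lambda>\<omega>. f \<omega> * w k \<omega>)"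
  proof (rule Bochner_Integration.integrable_bound)
    show "integrable M (\<lambda>\<omega>. \<bar>f \<omega>\<bar> + \<bar>f \<omega> * (w k \<omega>)\<^sup>2\<bar>)"
      using int 1 by auto
    have "\<bar>w k \<omega>\<bar> \<le> 1 + (w k \<omega>)\<^sup>2" for \<omega>
      using zero_le_power2[of "\<bar>w k \<omega>\<bar> - 1"] unfolding power2_diff by simp
    from mult_left_mono[OF this]
    show "AE \<omega> in M. norm (f \<omega> * w k \<omega>) \<le> norm (\<bar>f \<omega>\<bar> + \<bar>f \<omega> * (w k \<omega>)\<^sup>2\<bar>)"
      by (auto simp: abs_mult distrib_left)
  qed measurable
  have "(\<integral>\<omega>. f \<omega> * w k \<omega> \<partial>M) = (\<integral>\<omega>. f \<omega> * real_cond_exp M (H k) (w k) \<omega> \<partial>M)"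
    by (rule S.real_cond_exp_intg(2)[OF 2, symmetric]) measurable
  also have "\<dots> = (\<integral>\<omega>. 0 \<partial>M)"
    using white by (intro integral_cong_AE) (auto simp: conditionally_white_noise_def)
  finally show "(\<integral>\<omega>. f \<omega> * w k \<omega> \<partial>M) = 0" by simp
qed

text \<open>Cauchy-Schwarz and uniform bounds over the finitely many modes dominate the integrand by
  a multiple of the squared state norm. Separate families \<open>X\<close>, \<open>Q\<close>,
  \<open>Z\<close> let it serve cross terms, Lyapunov values and outputs alike.\<close>

lemma integrable_bilinear:
  fixes X Z :: "'s \<Rightarrow> real^'n^'n" and Q :: "'s \<Rightarrow> real^'n^'n"
  assumes sq: "integrable M (\<lambda>\<omega>. (norm (state k \<omega>))\<^sup>2)"
    and G [measurable]: "G \<in> borel_measurable M" and G1: "\<And>\<omega>. \<bar>G \<omega>\<bar> \<le> 1"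
  shows "integrable M (\<lambda>\<omega>. G \<omega> * ((X (r l \<omega>) *v state k \<omega>) \<bullet> (Q (r l \<omega>) *v (Z (r l \<omega>) *v state k \<omega>))))"
proof -
  obtain KX where KX: "KX \<ge> 0" "\<And>i v. norm (X i *v v) \<le> KX * norm v"
    using matrix_family_bound[of X] by blast
  obtain KQ where KQ: "KQ \<ge> 0" "\<And>i v. norm (Q i *v v) \<le> KQ * norm v"
    using matrix_family_bound[of Q] by blast
  obtain KZ where KZ: "KZ \<ge> 0" "\<And>i v. norm (Z i *v v) \<le> KZ * norm v"
    using matrix_family_bound[of Z] by blast
  have bound: "\<bar>G \<omega> * ((X i *v v) \<bullet> (Q i *v (Z i *v v)))\<bar> \<le> (KX * KQ * KZ) * (norm v)\<^sup>2" for i v \<omega>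
  proof -
    have "norm (Q i *v (Z i *v v)) \<le> KQ * (KZ * norm v)"
      using KQ(2)[of i "Z i *v v"] mult_left_mono[OF KZ(2) KQ(1)] by (rule order_trans)
    then have "norm (X i *v v) * norm (Q i *v (Z i *v v)) \<le> (KX * norm v) * (KQ * (KZ * norm v))"
      using KX by (intro mult_mono) auto
    then have "\<bar>(X i *v v) \<bullet> (Q i *v (Z i *v v))\<bar> \<le> (KX * norm v) * (KQ * (KZ * norm v))"
      using Cauchy_Schwarz_ineq2 order_trans by blast
    then have "\<bar>G \<omega>\<bar> * \<bar>(X i *v v) \<bullet> (Q i *v (Z i *v v))\<bar> \<le> 1 * ((KX * norm v) * (KQ * (KZ * norm v)))"
      using G1 by (intro mult_mono) auto
    then show ?thesis by (simp add: abs_mult power2_eq_square algebra_simps)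
  qed
  have [measurable]: "(\<lambda>\<omega>. U (r l \<omega>) *v f \<omega>) \<in> borel_measurable M"
    if "f \<in> borel_measurable M" for f and U :: "'s \<Rightarrow> real^'n^'n"
    using that by (rule borel_measurable_random_matrix_vector_mult[OF measurable_mode])
  show ?thesis
  proof (rule Bochner_Integration.integrable_bound)
    show "integrable M (\<lambda>\<omega>. (KX * KQ * KZ) * (norm (state k \<omega>))\<^sup>2)"
      using sq by simp
    show "AE \<omega> in M. norm (G \<omega> * ((X (r l \<omega>) *v state k \<omega>) \<bullet> (Q (r l \<omega>) *v (Z (r l \<omega>) *v state k \<omega>))))
        \<le> norm ((KX * KQ * KZ) * (norm (state k \<omega>))\<^sup>2)"
      unfolding real_norm_def by (intro AE_I2 order_trans[OF bound abs_ge_self])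
  qed measurable
qed

text \<open>In the expanded square the cross terms are linear in \<open>w k\<close> and integrate to
  0, while the squared noise acts as the factor 1. The weight \<open>G\<close> may depend on the
  whole mode path, since \<open>H k\<close> contains it.\<close>

lemma
  fixes Q :: "real^'n^'n"
  assumes sq: "integrable M (\<lambda>\<omega>. (norm (state k \<omega>))\<^sup>2)"
    and G [measurable]: "G \<in> borel_measurable (H k)" and G1: "\<And>\<omega>. \<bar>G \<omega>\<bar> \<le> 1"
  shows integrable_quadratic_Suc:
      "integrable M (\<lambda>\<omega>. G \<omega> * (state (Suc k) \<omega> \<bullet> (Q *v state (Suc k) \<omega>)))"
    and integral_quadratic_Suc:
      "(\<integral>\<omega>. G \<omega> * (state (Suc k) \<omega> \<bullet> (Q *v state (Suc k) \<omega>)) \<partial>M) =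
       (\<integral>\<omega>. G \<omega> * ((B (r k \<omega>) *v state k \<omega>) \<bullet> (Q *v (B (r k \<omega>) *v state k \<omega>)) +
               (D (r k \<omega>) *v state k \<omega>) \<bullet> (Q *v (D (r k \<omega>) *v state k \<omega>))) \<partial>M)"
proof -
  define form where "form X Z \<omega> = G \<omega> * ((X (r k \<omega>) *v state k \<omega>) \<bullet> (Q *v (Z (r k \<omega>) *v state k \<omega>)))"
    for X Z :: "'s \<Rightarrow> real^'n^'n" and \<omega>
  have [measurable]: "G \<in> borel_measurable M"
    using measurable_from_subalg[OF subalgebra_history G] .
  have int: "integrable M (form X Z)" for X Z
    unfolding form_def
    using integrable_bilinear[OF sq, where G = G and X = X and Q = "\<lambda>_. Q" and Z = Z] G1 by simp
  have meas: "form X Z \<in> borel_measurable (H k)" for X Z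
  proof -
    have [measurable]: "(\<lambda>\<omega>. U (r k \<omega>) *v state k \<omega>) \<in> borel_measurable (H k)"
      for U :: "'s \<Rightarrow> real^'n^'n"
      by (rule borel_measurable_random_matrix_vector_mult[OF measurable_mode_history measurable_state_history]) simp
    show ?thesis unfolding form_def by measurable
  qed
  let ?cross = "\<lambda>\<omega>. form B D \<omega> + form D B \<omega>"
  have cross: "?cross \<in> borel_measurable (H k)" "integrable M ?cross"
    using int meas by auto
  have eq: "G \<omega> * (state (Suc k) \<omega> \<bullet> (Q *v state (Suc k) \<omega>)) =
      form B B \<omega> + ?cross \<omega> * w k \<omega> + form D D \<omega> * (w k \<omega>)\<^sup>2" for \<omega>
    by (simp add: form_def matrix_vector_right_distrib matrix_vector_mult_scaleR inner_add_left
        inner_add_right algebra_simps power2_eq_square)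
  show "integrable M (\<lambda>\<omega>. G \<omega> * (state (Suc k) \<omega> \<bullet> (Q *v state (Suc k) \<omega>)))"
    unfolding eq
    by (intro Bochner_Integration.integrable_add int integrable_noise integrable_noise_square cross meas)
  have "(\<integral>\<omega>. G \<omega> * (state (Suc k) \<omega> \<bullet> (Q *v state (Suc k) \<omega>)) \<partial>M) =
      (\<integral>\<omega>. form B B \<omega> \<partial>M) + (\<integral>\<omega>. form D D \<omega> \<partial>M)"
    unfolding eq using integral_noise[OF cross] integrable_noise[OF cross]
      integrable_noise_square[OF meas int] integral_noise_square[OF meas int] int
    by simp
  also have "\<dots> = (\<integral>\<omega>. form B B \<omega> + form D D \<omega> \<partial>M)"
    using int by simp
  finally show "(\<integral>\<omega>. G \<omega> * (state (Suc k) \<omega> \<bullet> (Q *v state (Suc k) \<omega>)) \<partial>M) =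
       (\<integral>\<omega>. G \<omega> * ((B (r k \<omega>) *v state k \<omega>) \<bullet> (Q *v (B (r k \<omega>) *v state k \<omega>)) +
               (D (r k \<omega>) *v state k \<omega>) \<bullet> (Q *v (D (r k \<omega>) *v state k \<omega>))) \<partial>M)"
    by (simp add: form_def distrib_left)
qed

section \<open>Second moments along mode paths and the Markov property\<close>

lemma integrable_state_square: "integrable M (\<lambda>\<omega>. (norm (state k \<omega>))\<^sup>2)"
proof (induction k)
  case (Suc k)
  from integrable_quadratic_Suc[OF this, of "\<lambda>_. 1" "mat 1"]
  show ?case by (simp add: power2_norm_eq_inner)
qed simp

text \<open>Conditioning on a mode path is expressed by this weight under the integral, which avoids
  dividing by path probabilities that may be 0.\<close>

definition on_path :: "(nat \<Rightarrow> 's) \<Rightarrow> nat \<Rightarrow> 'w \<Rightarrow> real" where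
  "on_path s m \<omega> = of_bool (\<forall>l\<le>m. r l \<omega> = s l)"

lemma measurable_on_path_history [measurable]: "on_path s m \<in> borel_measurable (H k)"
  unfolding on_path_def by measurable

lemma measurable_on_path [measurable]: "on_path s m \<in> borel_measurable M"
  unfolding on_path_def by measurable

lemma abs_on_path_le: "\<bar>on_path s m \<omega>\<bar> \<le> 1"
  by (simp add: on_path_def)

text \<open>
  Given the whole mode path, the conditional second moments of \<open>state k\<close> depend only on the first
  \<open>k\<close> modes; this is where whiteness conditional on the future of the chain is needed, since the
  Markov property does not refer to the noise.
\<close>

lemma integral_quadratic_on_path:
  "\<exists>c. \<forall>m. k \<le> Suc m \<longrightarrow>
     (\<integral>\<omega>. on_path s m \<omega> * (state k \<omega> \<bullet> (Q *v state k \<omega>)) \<partial>M) = c * (\<integral>\<omega>. on_path s m \<omega> \<partial>M)"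
proof (induction k arbitrary: Q)
  case 0
  show ?case by (intro exI[of _ "y0 \<bullet> (Q *v y0)"]) simp
next
  case (Suc k)
  \<comment> \<open>\<open>T\<close> is the pull-back of \<open>Q\<close> through one step in mode
    \<open>s k\<close>, and the induction hypothesis is used for \<open>T\<close>. The constant it
    yields is independent of \<open>m\<close>, so paths of different lengths can be compared
    later.\<close>
  define T where "T = transpose (B (s k)) ** Q ** B (s k) + transpose (D (s k)) ** Q ** D (s k)"
  have T: "(B (s k) *v v) \<bullet> (Q *v (B (s k) *v v)) + (D (s k) *v v) \<bullet> (Q *v (D (s k) *v v)) = v \<bullet> (T *v v)" for v
    by (simp only: T_def matrix_vector_mult_add_rdistrib inner_add_right inner_transpose_vector_mult
       flip: matrix_vector_mul_assoc)
  obtain c where c: "\<And>m. k \<le> Suc m \<Longrightarrow>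
      (\<integral>\<omega>. on_path s m \<omega> * (state k \<omega> \<bullet> (T *v state k \<omega>)) \<partial>M) = c * (\<integral>\<omega>. on_path s m \<omega> \<partial>M)"
    using Suc.IH by blast
  show ?case
  proof (intro exI[of _ c] allI impI)
    fix m assume m: "Suc k \<le> Suc m"
    have "(\<integral>\<omega>. on_path s m \<omega> * (state (Suc k) \<omega> \<bullet> (Q *v state (Suc k) \<omega>)) \<partial>M) =
       (\<integral>\<omega>. on_path s m \<omega> * ((B (r k \<omega>) *v state k \<omega>) \<bullet> (Q *v (B (r k \<omega>) *v state k \<omega>)) +
               (D (r k \<omega>) *v state k \<omega>) \<bullet> (Q *v (D (r k \<omega>) *v state k \<omega>))) \<partial>M)"
      by (rule integral_quadratic_Suc[OF integrable_state_square measurable_on_path_history abs_on_path_le])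
    \<comment> \<open>Here \<open>k \<le> m\<close>, so the weight forces the random mode
      \<open>r k\<close> to be \<open>s k\<close>.\<close>
    also have "\<dots> = (\<integral>\<omega>. on_path s m \<omega> * (state k \<omega> \<bullet> (T *v state k \<omega>)) \<partial>M)"
      using m by (intro Bochner_Integration.integral_cong) (auto simp: on_path_def T)
    also have "\<dots> = c * (\<integral>\<omega>. on_path s m \<omega> \<partial>M)"
      using c m by simp
    finally show "(\<integral>\<omega>. on_path s m \<omega> * (state (Suc k) \<omega> \<bullet> (Q *v state (Suc k) \<omega>)) \<partial>M) =
      c * (\<integral>\<omega>. on_path s m \<omega> \<partial>M)" .
  qed
qed

lemma integral_on_path: "(\<integral>\<omega>. on_path s m \<omega> \<partial>M) = \<P>(\<omega> in M. \<forall>l\<le>m. r l \<omega> = s l)"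
proof -
  have "(\<integral>\<omega>. on_path s m \<omega> \<partial>M) = (\<integral>\<omega>. indicator {\<omega> \<in> space M. \<forall>l\<le>m. r l \<omega> = s l} \<omega> \<partial>M)"
    by (intro Bochner_Integration.integral_cong) (auto simp: on_path_def)
  then show ?thesis by simp
qed

text \<open>The Markov property in product form. It survives for paths of probability 0, where both
  sides vanish by monotonicity.\<close>

lemma integral_on_path_Suc:
  "(\<integral>\<omega>. on_path s (Suc k) \<omega> \<partial>M) = \<Lambda> (s k) (s (Suc k)) * (\<integral>\<omega>. on_path s k \<omega> \<partial>M)"
proof (cases "\<P>(\<omega> in M. \<forall>l\<le>k. r l \<omega> = s l) = 0")
  case True
  have "\<P>(\<omega> in M. \<forall>l\<le>Suc k. r l \<omega> = s l) \<le> \<P>(\<omega> in M. \<forall>l\<le>k. r l \<omega> = s l)"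
    by (intro finite_measure_mono) auto
  then show ?thesis
    using True by (simp add: integral_on_path measure_le_0_iff)
next
  case False
  have "\<P>(\<omega> in M. r (Suc k) \<omega> = s (Suc k) \<bar> \<forall>l\<le>k. r l \<omega> = s l) = \<Lambda> (s k) (s (Suc k))"
    using chain False unfolding markov_chain_def by blast
  moreover have "(\<forall>l\<le>Suc k. r l \<omega> = s l) \<longleftrightarrow> r (Suc k) \<omega> = s (Suc k) \<and> (\<forall>l\<le>k. r l \<omega> = s l)" for \<omega>
    by (auto simp: le_Suc_eq)
  ultimately show ?thesis
    using False by (simp add: integral_on_path cond_prob_def field_simps)
qed

text \<open>Both integrals are the same multiple \<open>c\<close> of their path probabilities, since
  \<open>state (Suc k)\<close> involves modes up to \<open>k\<close> only; the probabilities differ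
  by one transition factor.\<close>

lemma integral_quadratic_markov:
  "(\<integral>\<omega>. on_path s (Suc k) \<omega> * (state (Suc k) \<omega> \<bullet> (Q *v state (Suc k) \<omega>)) \<partial>M) =
   \<Lambda> (s k) (s (Suc k)) * (\<integral>\<omega>. on_path s k \<omega> * (state (Suc k) \<omega> \<bullet> (Q *v state (Suc k) \<omega>)) \<partial>M)"
proof -
  obtain c where c: "\<And>m. Suc k \<le> Suc m \<Longrightarrow>
      (\<integral>\<omega>. on_path s m \<omega> * (state (Suc k) \<omega> \<bullet> (Q *v state (Suc k) \<omega>)) \<partial>M) =
      c * (\<integral>\<omega>. on_path s m \<omega> \<partial>M)"
    using integral_quadratic_on_path[of "Suc k" s Q] by blast
  have "(\<integral>\<omega>. on_path s (Suc k) \<omega> * (state (Suc k) \<omega> \<bullet> (Q *v state (Suc k) \<omega>)) \<partial>M) =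
      c * (\<integral>\<omega>. on_path s (Suc k) \<omega> \<partial>M)"
    by (rule c) simp
  also have "\<dots> = \<Lambda> (s k) (s (Suc k)) * (c * (\<integral>\<omega>. on_path s k \<omega> \<partial>M))"
    by (simp only: integral_on_path_Suc mult.left_commute)
  finally show ?thesis
    by (simp only: c[OF order_refl])
qed

text \<open>Paths are taken as extensional functions on \<open>{..k}\<close>: there are finitely
  many of them, and each outcome follows exactly one.\<close>

lemma sum_on_path: "(\<Sum>s\<in>PiE {..k} (\<lambda>_. UNIV). on_path s k \<omega>) = 1"
proof -
  have "(\<Sum>s\<in>PiE {..k} (\<lambda>_. UNIV). on_path s k \<omega>) =
      (\<Sum>s\<in>PiE {..k} (\<lambda>_. UNIV). if s = restrict (\<lambda>l. r l \<omega>) {..k} then 1 else 0)"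
  proof (rule sum.cong[OF refl])
    fix s :: "nat \<Rightarrow> 's" assume "s \<in> PiE {..k} (\<lambda>_. UNIV)"
    then have s: "restrict s {..k} = s"
      by (rule PiE_restrict)
    have "(\<forall>l\<le>k. r l \<omega> = s l) \<longleftrightarrow> restrict s {..k} = restrict (\<lambda>l. r l \<omega>) {..k}"
      by (simp add: fun_eq_iff restrict_def) metis
    then have "(\<forall>l\<le>k. r l \<omega> = s l) \<longleftrightarrow> s = restrict (\<lambda>l. r l \<omega>) {..k}"
      unfolding s .
    then show "on_path s k \<omega> = (if s = restrict (\<lambda>l. r l \<omega>) {..k} then 1 else 0)"
      by (simp add: on_path_def)
  qed
  then show ?thesis by (simp add: finite_PiE)
qed

lemma sum_on_path_Suc: "(\<Sum>j\<in>UNIV. on_path (s(Suc k := j)) (Suc k) \<omega> * f j) = on_path s k \<omega> * f (r (Suc k) \<omega>)"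
proof -
  have "on_path (s(Suc k := j)) (Suc k) \<omega> * f j = (if j = r (Suc k) \<omega> then on_path s k \<omega> * f j else 0)" for j
    by (auto simp: on_path_def le_Suc_eq)
  then show ?thesis by simp
qed

text \<open>Split by the path up to \<open>k\<close> and the next mode. The Markov step averages
  \<open>P\<close> over the next mode into \<open>X\<close>, the noise is then integrated out, and
  the path pieces are reassembled.\<close>

lemma integral_lyapunov_Suc:
  fixes P :: "'s \<Rightarrow> real^'n^'n"
  defines "X \<equiv> \<lambda>i. \<Sum>j\<in>UNIV. \<Lambda> i j *\<^sub>R P j"
  shows "(\<integral>\<omega>. state (Suc k) \<omega> \<bullet> (P (r (Suc k) \<omega>) *v state (Suc k) \<omega>) \<partial>M) =
    (\<integral>\<omega>. (B (r k \<omega>) *v state k \<omega>) \<bullet> (X (r k \<omega>) *v (B (r k \<omega>) *v state k \<omega>)) +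
          (D (r k \<omega>) *v state k \<omega>) \<bullet> (X (r k \<omega>) *v (D (r k \<omega>) *v state k \<omega>)) \<partial>M)"
proof -
  let ?S = "PiE {..k} (\<lambda>_. UNIV) :: (nat \<Rightarrow> 's) set"
  let ?y = "state (Suc k)"
  let ?z = "\<lambda>Q \<omega>. (B (r k \<omega>) *v state k \<omega>) \<bullet> (Q *v (B (r k \<omega>) *v state k \<omega>)) +
          (D (r k \<omega>) *v state k \<omega>) \<bullet> (Q *v (D (r k \<omega>) *v state k \<omega>))"
  have int: "integrable M (\<lambda>\<omega>. on_path s m \<omega> * (?y \<omega> \<bullet> (Q *v ?y \<omega>)))" for s m Q
    by (rule integrable_quadratic_Suc[OF integrable_state_square measurable_on_path_history abs_on_path_le])
  have int': "integrable M (\<lambda>\<omega>. on_path s k \<omega> * ?z (X (r k \<omega>)) \<omega>)" for s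
    unfolding distrib_left
    by (intro Bochner_Integration.integrable_add integrable_bilinear[OF integrable_state_square _ abs_on_path_le])
      measurable
  have X: "(\<Sum>j\<in>UNIV. \<Lambda> i j * (v \<bullet> (P j *v v))) = v \<bullet> (X i *v v)" for i v
    by (simp add: X_def inner_sum_right sum_matrix_vector_mult scaleR_matrix_vector_assoc[symmetric])
  have "(\<integral>\<omega>. ?y \<omega> \<bullet> (P (r (Suc k) \<omega>) *v ?y \<omega>) \<partial>M) =
      (\<integral>\<omega>. (\<Sum>s\<in>?S. \<Sum>j\<in>UNIV. on_path (s(Suc k := j)) (Suc k) \<omega> * (?y \<omega> \<bullet> (P j *v ?y \<omega>))) \<partial>M)"
    unfolding sum_on_path_Suc by (simp add: sum_on_path del: state.simps flip: sum_distrib_right)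
  also have "\<dots> = (\<Sum>s\<in>?S. \<Sum>j\<in>UNIV. \<integral>\<omega>. on_path (s(Suc k := j)) (Suc k) \<omega> * (?y \<omega> \<bullet> (P j *v ?y \<omega>)) \<partial>M)"
    using int by (simp add: Bochner_Integration.integral_sum del: state.simps)
  also have "\<dots> = (\<Sum>s\<in>?S. \<Sum>j\<in>UNIV. \<Lambda> (s k) j * (\<integral>\<omega>. on_path s k \<omega> * (?y \<omega> \<bullet> (P j *v ?y \<omega>)) \<partial>M))"
  proof (intro sum.cong refl)
    fix s :: "nat \<Rightarrow> 's" and j
    have "on_path (s(Suc k := j)) k = on_path s k"
      by (auto simp: on_path_def fun_eq_iff)
    then show "(\<integral>\<omega>. on_path (s(Suc k := j)) (Suc k) \<omega> * (?y \<omega> \<bullet> (P j *v ?y \<omega>)) \<partial>M) =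
        \<Lambda> (s k) j * (\<integral>\<omega>. on_path s k \<omega> * (?y \<omega> \<bullet> (P j *v ?y \<omega>)) \<partial>M)"
      using integral_quadratic_markov[of "s(Suc k := j)" k "P j"] by (simp del: state.simps)
  qed
  also have "\<dots> = (\<Sum>s\<in>?S. \<integral>\<omega>. (\<Sum>j\<in>UNIV. \<Lambda> (s k) j * (on_path s k \<omega> * (?y \<omega> \<bullet> (P j *v ?y \<omega>)))) \<partial>M)"
    using int by (simp add: Bochner_Integration.integral_sum del: state.simps)
  also have "\<dots> = (\<Sum>s\<in>?S. \<integral>\<omega>. on_path s k \<omega> * (?y \<omega> \<bullet> (X (s k) *v ?y \<omega>)) \<partial>M)"
  proof -
    have "(\<Sum>j\<in>UNIV. \<Lambda> i j * (p * (v \<bullet> (P j *v v)))) = p * (v \<bullet> (X i *v v))" for i p v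
      by (simp add: sum_distrib_left mult.left_commute flip: X)
    then show ?thesis by simp
  qed
  also have "\<dots> = (\<Sum>s\<in>?S. \<integral>\<omega>. on_path s k \<omega> * ?z (X (s k)) \<omega> \<partial>M)"
    by (intro sum.cong refl integral_quadratic_Suc[OF integrable_state_square measurable_on_path_history abs_on_path_le])
  \<comment> \<open>On the support of the weight the fixed mode \<open>s k\<close> equals
    \<open>r k\<close>. With the random mode in place the integrand no longer depends on
    \<open>s\<close> except through the weight, and the path weights sum to 1.\<close>
  also have "\<dots> = (\<Sum>s\<in>?S. \<integral>\<omega>. on_path s k \<omega> * ?z (X (r k \<omega>)) \<omega> \<partial>M)"
    by (intro sum.cong refl Bochner_Integration.integral_cong) (auto simp: on_path_def)
  also have "\<dots> = (\<integral>\<omega>. (\<Sum>s\<in>?S. on_path s k \<omega> * ?z (X (r k \<omega>)) \<omega>) \<partial>M)"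
    using int' by (simp add: Bochner_Integration.integral_sum)
  also have "\<dots> = (\<integral>\<omega>. ?z (X (r k \<omega>)) \<omega> \<partial>M)"
    by (simp add: sum_on_path flip: sum_distrib_right)
  finally show ?thesis .
qed

text \<open>Telescoping: the expected Lyapunov value \<open>V k\<close> is nonnegative and drops by
  at least \<open>\<alpha>\<close> times the output moment, so the partial sums stay below
  \<open>V 0 / \<alpha>\<close>. The inequalities are posed on a subspace \<open>R\<close>
  containing all states, because in the application \<open>P i\<close> may be indefinite off the
  range of \<open>E\<close>.\<close>

lemma
  fixes P F :: "'s \<Rightarrow> real^'n^'n"
  defines "X \<equiv> \<lambda>i. \<Sum>j\<in>UNIV. \<Lambda> i j *\<^sub>R P j"
  assumes R: "subspace R" "y0 \<in> R" "\<And>i v. B i *v v \<in> R" "\<And>i v. D i *v v \<in> R"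
    and pos: "\<And>i v. v \<in> R \<Longrightarrow> 0 \<le> v \<bullet> (P i *v v)"
    and \<alpha>: "\<alpha> > 0"
    and dec: "\<And>i v. v \<in> R \<Longrightarrow>
      (B i *v v) \<bullet> (X i *v (B i *v v)) + (D i *v v) \<bullet> (X i *v (D i *v v)) + \<alpha> * (norm (F i *v v))\<^sup>2
      \<le> v \<bullet> (P i *v v)"
  shows integrable_output: "integrable M (\<lambda>\<omega>. (norm (F (r k \<omega>) *v state k \<omega>))\<^sup>2)"
    and summable_output: "summable (\<lambda>k. \<integral>\<omega>. (norm (F (r k \<omega>) *v state k \<omega>))\<^sup>2 \<partial>M)"
proof -
  have state: "state k \<omega> \<in> R" for k \<omega>
    by (induction k) (auto intro!: subspace_add[OF R(1)] subspace_scale[OF R(1)] R)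
  have int: "integrable M (\<lambda>\<omega>. (Y (r l \<omega>) *v state k \<omega>) \<bullet> (Q (r l \<omega>) *v (Z (r l \<omega>) *v state k \<omega>)))"
    for Y Q Z :: "'s \<Rightarrow> real^'n^'n" and k l
    using integrable_bilinear[OF integrable_state_square, where G = "\<lambda>_. 1"] by simp
  show intF: "integrable M (\<lambda>\<omega>. (norm (F (r k \<omega>) *v state k \<omega>))\<^sup>2)" for k
    using int[of F k k "\<lambda>_. mat 1" F] by (simp add: power2_norm_eq_inner)
  have intP: "integrable M (\<lambda>\<omega>. state k \<omega> \<bullet> (P (r k \<omega>) *v state k \<omega>))" for k
    using int[of "\<lambda>_. mat 1" k k P "\<lambda>_. mat 1"] by simp
  define V where "V k = (\<integral>\<omega>. state k \<omega> \<bullet> (P (r k \<omega>) *v state k \<omega>) \<partial>M)" for k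
  define a where "a k = (\<integral>\<omega>. (norm (F (r k \<omega>) *v state k \<omega>))\<^sup>2 \<partial>M)" for k
  have V0: "V k \<ge> 0" for k
    unfolding V_def by (intro Bochner_Integration.integral_nonneg pos state)
  have "V (Suc k) + \<alpha> * a k \<le> V k" for k
  proof -
    let ?z = "\<lambda>\<omega>. (B (r k \<omega>) *v state k \<omega>) \<bullet> (X (r k \<omega>) *v (B (r k \<omega>) *v state k \<omega>)) +
          (D (r k \<omega>) *v state k \<omega>) \<bullet> (X (r k \<omega>) *v (D (r k \<omega>) *v state k \<omega>))"
    have int_z: "integrable M ?z"
      using int[of B k k X B] int[of D k k X D] by simp
    have "V (Suc k) + \<alpha> * a k = (\<integral>\<omega>. ?z \<omega> + \<alpha> * (norm (F (r k \<omega>) *v state k \<omega>))\<^sup>2 \<partial>M)"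
    proof -
      have "V (Suc k) = (\<integral>\<omega>. ?z \<omega> \<partial>M)"
        unfolding V_def X_def by (rule integral_lyapunov_Suc)
      then show ?thesis
        using int_z intF[of k] by (simp add: a_def)
    qed
    also have "\<dots> \<le> V k"
      unfolding V_def using int_z intF[of k] intP[of k] dec[OF state] by (intro integral_mono) auto
    finally show ?thesis .
  qed
  then have "\<alpha> * (\<Sum>k<n. a k) \<le> V 0 - V n" for n
  proof (induction n)
    case (Suc n)
    have "V (Suc n) + \<alpha> * a n \<le> V n" by (rule Suc.prems)
    then show ?case using Suc.IH[OF Suc.prems] by (simp add: distrib_left)
  qed simp
  then have "(\<Sum>k<n. a k) \<le> V 0 / \<alpha>" for n
    using V0[of n] \<alpha> by (simp add: field_simps) (smt (verit))
  moreover have "a k \<ge> 0" for k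
    unfolding a_def by simp
  ultimately show "summable (\<lambda>k. \<integral>\<omega>. (norm (F (r k \<omega>) *v state k \<omega>))\<^sup>2 \<partial>M)"
    unfolding a_def[symmetric] by (intro summableI_nonneg_bounded) auto
qed

end

text \<open>The series of conditional expectations has integral equal to the sum of the
  expectations, which is finite. Hence it converges almost everywhere, and its terms tend to
  0.\<close>

lemma nn_cond_exp_tendsto_0:
  fixes f :: "nat \<Rightarrow> 'w \<Rightarrow> real"
  assumes "sigma_finite_subalgebra M F"
    and int: "\<And>k. integrable M (f k)" and nonneg: "\<And>k \<omega>. 0 \<le> f k \<omega>"
    and sum: "summable (\<lambda>k. \<integral>\<omega>. f k \<omega> \<partial>M)"
  shows "AE \<omega> in M. (\<lambda>k. nn_cond_exp M F (\<lambda>\<omega>. ennreal (f k \<omega>)) \<omega>) \<longlonglongrightarrow> 0"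
proof -
  interpret sigma_finite_subalgebra M F by fact
  let ?g = "\<lambda>k. nn_cond_exp M F (\<lambda>\<omega>. ennreal (f k \<omega>))"
  have [measurable]: "f k \<in> borel_measurable M" for k
    using int by auto
  have "(\<integral>\<^sup>+\<omega>. (\<Sum>k. ?g k \<omega>) \<partial>M) = (\<Sum>k. \<integral>\<^sup>+\<omega>. ?g k \<omega> \<partial>M)"
    by (intro nn_integral_suminf) measurable
  also have "\<dots> = (\<Sum>k. \<integral>\<^sup>+\<omega>. ennreal (f k \<omega>) \<partial>M)"
    using nn_cond_exp_intg[of "\<lambda>_. 1"] by (intro suminf_cong) simp
  also have "\<dots> = (\<Sum>k. ennreal (\<integral>\<omega>. f k \<omega> \<partial>M))"
    using int nonneg by (intro suminf_cong nn_integral_eq_integral) auto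
  also have "\<dots> \<noteq> \<infinity>"
    using sum nonneg by (simp add: suminf_ennreal2)
  finally have "AE \<omega> in M. (\<Sum>k. ?g k \<omega>) \<noteq> \<infinity>"
    by (intro nn_integral_PInf_AE) measurable
  then show ?thesis
  proof eventually_elim
    case (elim \<omega>)
    then have "?g k \<omega> < top" for k
      using ennreal_suminf_lessD[of "\<lambda>k. ?g k \<omega>" top k] by (simp add: less_top)
    then have g: "?g k \<omega> = ennreal (enn2real (?g k \<omega>))" for k
      by (simp add: less_top)
    with elim have "summable (\<lambda>k. enn2real (?g k \<omega>))"
      by (intro summable_suminf_not_top) auto
    then have "(\<lambda>k. enn2real (?g k \<omega>)) \<longlonglongrightarrow> 0"
      by (rule summable_LIMSEQ_zero)
    then show "(\<lambda>k. ?g k \<omega>) \<longlonglongrightarrow> 0"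
      using g tendsto_ennrealI by fastforce
  qed
qed

section \<open>Mean square admissibility\<close>

lemma inner_congruence:
  fixes X Y :: "real^'n^'n"
  shows "v \<bullet> ((transpose Y ** X ** Y) *v v) = (Y *v v) \<bullet> (X *v (Y *v v))"
  by (simp only: inner_transpose_vector_mult flip: matrix_vector_mul_assoc)

theorem theorem5:
  fixes M :: "'w measure"
    and r :: "nat \<Rightarrow> 'w \<Rightarrow> 's::finite"
    and w :: "nat \<Rightarrow> 'w \<Rightarrow> real"
    and \<Lambda> :: "'s \<Rightarrow> 's \<Rightarrow> real"
    and E :: "real^'n^'n"
    and A C P :: "'s \<Rightarrow> real^'n^'n"
  assumes "prob_space M"
    and "markov_chain M r \<Lambda>"
    and "wide_stationary_noise M w"
    and "conditionally_white_noise M r w"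
    and "\<And>i. rank (hconcat E (C i)) = rank E"
    and "\<And>i. transpose (P i) = P i"
    and "\<And>i. pos_semidefinite (transpose E ** P i ** E)"
    and "\<And>i. neg_definite
           (transpose (A i) ** (\<Sum>j\<in>UNIV. \<Lambda> i j *\<^sub>R P j) ** A i
            + transpose (C i) ** (\<Sum>j\<in>UNIV. \<Lambda> i j *\<^sub>R P j) ** C i
            - transpose E ** P i ** E)"
  shows "mean_square_admissible M r w E A C"
proof -
  interpret prob_space M by fact
  define X where "X i = (\<Sum>j\<in>UNIV. \<Lambda> i j *\<^sub>R P j)" for i
  have P: "0 \<le> (E *v v) \<bullet> (P i *v (E *v v))" for i v
    using assms(7)[of i] by (simp add: pos_semidefinite_def flip: inner_congruence)
  \<comment> \<open>On the range of \<open>E\<close> each \<open>P j\<close> is nonnegative, and the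
    weights \<open>\<Lambda> i j\<close> preserve this.\<close>
  have X: "0 \<le> (E *v v) \<bullet> (X i *v (E *v v))" for i v
  proof -
    have "0 \<le> \<Lambda> i j" for j
      using assms(2) by (auto simp: markov_chain_def transition_matrix_def)
    then have "0 \<le> (\<Sum>j\<in>UNIV. \<Lambda> i j * ((E *v v) \<bullet> (P j *v (E *v v))))"
      using P by (intro sum_nonneg mult_nonneg_nonneg) auto
    then show ?thesis
      by (simp add: X_def sum_matrix_vector_mult inner_sum_right scaleR_matrix_vector_assoc[symmetric])
  qed
  have C: "\<exists>u. C i *v v = E *v u" for i v
    using range_subset_of_rank_hconcat assms(5) .
  define L where "L i = transpose (A i) ** X i ** A i + transpose (C i) ** X i ** C i - transpose E ** P i ** E" for i
  have L: "v \<bullet> (L i *v v) = (A i *v v) \<bullet> (X i *v (A i *v v)) + (C i *v v) \<bullet> (X i *v (C i *v v))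
      - (E *v v) \<bullet> (P i *v (E *v v))" for i v
    by (simp only: L_def matrix_vector_mult_add_rdistrib matrix_vector_mult_diff_rdistrib
        inner_add_right inner_diff_right inner_congruence)
  have negL: "neg_definite (L i)" for i
    using assms(8) by (simp add: L_def X_def)
  then have "\<exists>a>0. \<forall>v. v \<bullet> (L i *v v) \<le> - a * (norm v)\<^sup>2" for i
    using neg_definite_coercive by metis
  then obtain a where a: "\<And>i. a i > 0" "\<And>i v. v \<bullet> (L i *v v) \<le> - a i * (norm v)\<^sup>2"
    by metis
  \<comment> \<open>With finitely many modes one coercivity constant serves them all.\<close>
  define \<alpha> where "\<alpha> = Min (range a)"
  have "\<alpha> > 0" and "\<alpha> \<le> a i" for i
    using a(1) by (auto simp: \<alpha>_def)
  then have \<alpha>: "v \<bullet> (L i *v v) + \<alpha> * (norm v)\<^sup>2 \<le> 0" for i v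
    using a(2)[of v i] mult_right_mono[of \<alpha> "a i" "(norm v)\<^sup>2"] by auto

  have pencil: "index_one_pencil E (A i)" for i
  proof
    fix v u assume v: "E *v v = 0" and u: "A i *v v = E *v u"
    \<comment> \<open>For this \<open>v\<close> the term with \<open>P\<close> vanishes and both
      terms with \<open>X\<close> are evaluated on the range of \<open>E\<close>, so the form is
      nonnegative; negative definiteness leaves only 0.\<close>
    obtain z where "C i *v v = E *v z" using C by blast
    then have "0 \<le> v \<bullet> (L i *v v)"
      unfolding L u v using X by simp
    then show "v = 0"
      using negL[of i] by (auto simp: neg_definite_def not_less[symmetric])
  qed
  have causal: "causal E A C"
    unfolding causal_def using index_one_pencil.causal_form[OF pencil C] by blast

  have "\<exists>F. (\<forall>y. \<exists>u. A i *v (F *v y) = E *v u) \<and> (\<forall>v u. A i *v v = E *v u \<longrightarrow> F *v (E *v v) = v) \<and>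
      (\<forall>v. E *v (F *v (E *v v)) = E *v v)" for i
    using index_one_pencil.ex_consistent_inverse[OF pencil[of i]]
    unfolding index_one_pencil.consistent_def[OF pencil] mem_Collect_eq by metis
  then obtain F :: "'s \<Rightarrow> real^'n^'n" where
    AF: "\<And>i y. \<exists>u. A i *v (F i *v y) = E *v u" and
    FE: "\<And>i v u. A i *v v = E *v u \<Longrightarrow> F i *v (E *v v) = v" and
    EFE: "\<And>i v. E *v (F i *v (E *v v)) = E *v v"
    by metis
  interpret J: white_noise_jump_system M r w \<Lambda> "\<lambda>i. A i ** F i" "\<lambda>i. C i ** F i" "E *v x0" for x0
    by unfold_locales fact+
  define xs where "xs x0 k \<omega> = F (r k \<omega>) *v J.state x0 k \<omega>" for x0 k \<omega>
  have state_Suc: "J.state x0 (Suc k) \<omega> = A (r k \<omega>) *v xs x0 k \<omega> + w k \<omega> *\<^sub>R (C (r k \<omega>) *v xs x0 k \<omega>)"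
    for x0 k \<omega>
    by (simp add: xs_def matrix_vector_mul_assoc)
  \<comment> \<open>Every state lies in the range of \<open>E\<close>: initially as
    \<open>E x0\<close>, later because \<open>A F\<close> and \<open>C\<close> map into it. There
    \<open>E F\<close> is the identity.\<close>
  have E_xs: "E *v xs x0 k \<omega> = J.state x0 k \<omega>" for x0 k \<omega>
  proof -
    have "\<exists>u. J.state x0 k \<omega> = E *v u"
    proof (cases k)
      case (Suc l)
      obtain u1 u2 where "A (r l \<omega>) *v xs x0 l \<omega> = E *v u1" "C (r l \<omega>) *v xs x0 l \<omega> = E *v u2"
        using AF C unfolding xs_def by metis
      then have "J.state x0 k \<omega> = E *v (u1 + w l \<omega> *\<^sub>R u2)"
        unfolding Suc state_Suc by (simp add: matrix_vector_right_distrib matrix_vector_mult_scaleR)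
      then show ?thesis ..
    qed auto
    then show ?thesis using EFE by (auto simp: xs_def)
  qed
  have xs: "solution M r w E A C x0 (xs x0)" for x0
    unfolding solution_def E_xs state_Suc
    by (auto simp: xs_def[abs_def] intro!: borel_measurable_random_matrix_vector_mult)
  have solution_xs: "AE \<omega> in M. \<forall>k. x k \<omega> = xs x0 k \<omega>" if "solution M r w E A C x0 x" for x0 x
  proof -
    have "AE \<omega> in M. E *v x 0 \<omega> = E *v x0"
      and "AE \<omega> in M. \<forall>k. E *v x (Suc k) \<omega> = A (r k \<omega>) *v x k \<omega> + w k \<omega> *\<^sub>R (C (r k \<omega>) *v x k \<omega>)"
      using that by (auto simp: solution_def)
    then show ?thesis
    proof eventually_elim
      case (elim \<omega>)
      \<comment> \<open>The noise term lies in the range of \<open>E\<close> and can be absorbed on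
        the left. So the equation of step \<open>k\<close> itself makes \<open>x k\<close>
        consistent for its current mode, and \<open>F\<close> recovers it from \<open>E x k\<close>
        without any choice.\<close>
      have F: "F (r k \<omega>) *v (E *v x k \<omega>) = x k \<omega>" for k
      proof -
        obtain u where u: "C (r k \<omega>) *v x k \<omega> = E *v u" using C by blast
        have "A (r k \<omega>) *v x k \<omega> = E *v (x (Suc k) \<omega> - w k \<omega> *\<^sub>R u)"
          using elim(2) by (simp add: matrix_vector_mult_diff_distrib matrix_vector_mult_scaleR u)
        then show ?thesis by (rule FE)
      qed
      have "E *v x k \<omega> = J.state x0 k \<omega>" for k
      proof (induction k)
        case 0
        then show ?case using elim(1) by simp
      next
        case (Suc k)
        then have "x k \<omega> = xs x0 k \<omega>"
          using F[of k] by (simp add: xs_def)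
        then show ?case using elim(2) by (simp only: state_Suc)
      qed
      then show ?case using F by (simp add: xs_def)
    qed
  qed
  have unique: "has_unique_solution M r w E A C"
    unfolding has_unique_solution_def
  proof (intro allI conjI impI)
    fix x0 x y assume "solution M r w E A C x0 x \<and> solution M r w E A C x0 y"
    then have "AE \<omega> in M. \<forall>k. x k \<omega> = xs x0 k \<omega>" "AE \<omega> in M. \<forall>k. y k \<omega> = xs x0 k \<omega>"
      using solution_xs by auto
    then show "AE \<omega> in M. \<forall>k. x k \<omega> = y k \<omega>"
      by eventually_elim simp
  qed (use xs in blast)

  \<comment> \<open>This is the coercive inequality at the vector \<open>F i v\<close>, with
    \<open>E (F i v) = v\<close> on the range of \<open>E\<close>.\<close>
  have dec: "((A i ** F i) *v v) \<bullet> (X i *v ((A i ** F i) *v v)) + ((C i ** F i) *v v) \<bullet> (X i *v ((C i ** F i) *v v))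
      + \<alpha> * (norm (F i *v v))\<^sup>2 \<le> v \<bullet> (P i *v v)" if "v \<in> range ((*v) E)" for i v
  proof -
    have "E *v (F i *v v) = v" using that EFE by auto
    then show ?thesis
      using \<alpha>[of "F i *v v" i] unfolding L by (simp add: matrix_vector_mul_assoc)
  qed
  have range_AF: "(A i ** F i) *v v \<in> range ((*v) E)" and range_CF: "(C i ** F i) *v v \<in> range ((*v) E)" for i v
    using AF C by (metis matrix_vector_mul_assoc rangeI)+
  have sub: "subspace (range ((*v) E))"
    by (auto intro: linear_subspace_image)
  \<comment> \<open>The hole is the nonnegativity of \<open>P\<close> on the range of
    \<open>E\<close>, supplied at each use.\<close>
  note decay = sub rangeI range_AF range_CF _ \<open>\<alpha> > 0\<close> dec[unfolded X_def]
  have int: "integrable M (\<lambda>\<omega>. (norm (xs x0 k \<omega>))\<^sup>2)" for x0 k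
    unfolding xs_def by (rule J.integrable_output[OF decay]) (use P in auto)
  have sum: "summable (\<lambda>k. \<integral>\<omega>. (norm (xs x0 k \<omega>))\<^sup>2 \<partial>M)" for x0
    unfolding xs_def by (rule J.summable_output[OF decay]) (use P in auto)
  have "asymptotically_stable_ms M r w E A C"
    unfolding asymptotically_stable_ms_def cond_second_moment_def
  proof (intro conjI allI impI unique nn_cond_exp_tendsto_0)
    interpret finite_measure_subalgebra M "vimage_algebra (space M) (r 0) (count_space UNIV)"
    proof
      show "subalgebra M (vimage_algebra (space M) (r 0) (count_space UNIV))"
        unfolding subalgebra_def sets_vimage_algebra space_vimage_algebra
        by (intro conjI refl sets.sigma_sets_subset) (auto intro: measurable_sets[OF J.measurable_mode])
    qed
    show "sigma_finite_subalgebra M (vimage_algebra (space M) (r 0) (count_space UNIV))"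
      by unfold_locales
    fix x0 x assume x: "solution M r w E A C x0 x"
    have meas [measurable]: "x k \<in> borel_measurable M" "xs x0 k \<in> borel_measurable M" for k
      using x xs[of x0] by (auto simp: solution_def)
    have "AE \<omega> in M. \<forall>k. x k \<omega> = xs x0 k \<omega>"
      by (rule solution_xs[OF x])
    \<comment> \<open>Stability concerns every solution; integrability and summability pass from the
      constructed solution to \<open>x\<close> through almost sure equality.\<close>
    then have AE: "AE \<omega> in M. (norm (xs x0 k \<omega>))\<^sup>2 = (norm (x k \<omega>))\<^sup>2" for k
      by eventually_elim simp
    show "integrable M (\<lambda>\<omega>. (norm (x k \<omega>))\<^sup>2)" for k
      using int[of x0 k] by (rule integrable_cong_AE_imp) (use AE in \<open>auto simp: eq_commute\<close>)
    have "(\<integral>\<omega>. (norm (xs x0 k \<omega>))\<^sup>2 \<partial>M) = (\<integral>\<omega>. (norm (x k \<omega>))\<^sup>2 \<partial>M)" for k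
      using AE by (intro integral_cong_AE) auto
    then show "summable (\<lambda>k. \<integral>\<omega>. (norm (x k \<omega>))\<^sup>2 \<partial>M)"
      using sum[of x0] by simp
  qed simp
  then show ?thesis
    unfolding mean_square_admissible_def using unique causal by blast
qed

end
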